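(* Let $L$ be a completely distributive lattice and let $f:G\to H$ be a surjective group homomorphism. Let $\mu$ be an $L$-subgroup of $G$ such that $\mu$ possesses the sup-property. If $\eta$ is an abnormal $L$-subgroup of $\mu$, then $f(\eta)$ is an abnormal $L$-subgroup of $f(\mu)$.
   Context: $L$ is a completely distributive (in particular complete) lattice with greatest element $1$ and least element $0$. For a group $G$, an $L$-subset of $G$ is a function $G\to L$; $\eta\subseteq\nu$ means $\eta(x)\le\nu(x)$ for all $x\in G$; $(\eta\cup\nu)(x)=\eta(x)\vee\nu(x)$. An $L$-subgroup of $G$ is an $L$-subset $\mu$ with $\mu(xy)\ge\mu(x)\wedge\mu(y)$ and $\mu(x^{-1})=\mu(x)$ for all $x,y\in G$. An $L$-subgroup of $\mu$ is an $L$-subgroup $\eta$ of $G$ with $\eta\subseteq\mu$. $\mu$ possesses the sup-property if for each non-empty $A\subseteq G$ there exists $a_0\in A$ with $\bigvee_{a\in A}\mu(a)=\mu(a_0)$. For a group homomorphism $f:G\to H$ and an $L$-subset $\mu$ of $G$, the image is the $L$-subset of $H$ given by $f(\mu)(y)=\bigvee\{\mu(x)\mid x\in G,\ f(x)=y\}$ (supremum of the empty set being $0$). If $\mu$ is an $L$-subgroup of $G$ then $f(\mu)$ is an $L$-subgroup of $H$. For $a\in L$, $x\in G$, the $L$-point $a_x$ is the $L$-subset with value $a$ at $x$ and $0$ elsewhere; $a_x\in\mu$ means $\mu(x)\ge a$. For $\eta$ an $L$-subgroup of $\mu$ and $a_z\in\mu$, the conjugate $\eta^{a_z}$ is the $L$-subset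 $\eta^{a_z}(x)=a\wedge\eta(zxz^{-1})$, $x\in G$ (it is an $L$-subgroup of $\mu$). For $L$-subsets $\eta,\nu\subseteq\mu$, $\langle\eta,\nu\rangle$ is the $L$-subgroup of $\mu$ generated by $\eta\cup\nu$, i.e. the pointwise infimum of all $L$-subgroups $\theta$ of $\mu$ with $\eta\cup\nu\subseteq\theta$. An $L$-subgroup $\eta$ of $\mu$ is an abnormal $L$-subgroup of $\mu$ if for every $L$-point $a_x\in\mu$ one has $a_x\in\langle\eta,\eta^{a_x}\rangle$. *)

theory Defs
  imports "HOL-Algebra.Group"
begin

text \<open>
  The lattice \<open>L\<close> is a type of class \<^class>\<open>complete_distrib_lattice\<close>; this class is the full
  (choice-function) complete distributivity, not merely the frame law, and its least and
  greatest elements are \<open>bot\<close> and \<open>top\<close>.  An \<open>L\<close>-subset of a group \<open>G\<close> is a function of which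
  only the values on \<open>carrier G\<close> matter: every notion below inspects just these.
\<close>

definition lsubset_le :: "('a, 'm) monoid_scheme \<Rightarrow> ('a \<Rightarrow> 'l::complete_distrib_lattice) \<Rightarrow> ('a \<Rightarrow> 'l) \<Rightarrow> bool"
  where "lsubset_le G \<eta> \<nu> \<longleftrightarrow> (\<forall>x\<in>carrier G. \<eta> x \<le> \<nu> x)"

definition lunion :: "('a \<Rightarrow> 'l::complete_distrib_lattice) \<Rightarrow> ('a \<Rightarrow> 'l) \<Rightarrow> 'a \<Rightarrow> 'l"
  where "lunion \<eta> \<nu> = (\<lambda>x. sup (\<eta> x) (\<nu> x))"

definition lsubgroup :: "('a, 'm) monoid_scheme \<Rightarrow> ('a \<Rightarrow> 'l::complete_distrib_lattice) \<Rightarrow> bool"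
  where "lsubgroup G \<mu> \<longleftrightarrow>
    (\<forall>x\<in>carrier G. \<forall>y\<in>carrier G. inf (\<mu> x) (\<mu> y) \<le> \<mu> (x \<otimes>\<^bsub>G\<^esub> y)) \<and>
    (\<forall>x\<in>carrier G. \<mu> (inv\<^bsub>G\<^esub> x) = \<mu> x)"

definition lsubgroup_of ::
  "('a, 'm) monoid_scheme \<Rightarrow> ('a \<Rightarrow> 'l::complete_distrib_lattice) \<Rightarrow> ('a \<Rightarrow> 'l) \<Rightarrow> bool"
  where "lsubgroup_of G \<mu> \<eta> \<longleftrightarrow> lsubgroup G \<eta> \<and> lsubset_le G \<eta> \<mu>"

definition sup_property :: "('a, 'm) monoid_scheme \<Rightarrow> ('a \<Rightarrow> 'l::complete_distrib_lattice) \<Rightarrow> bool"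
  where "sup_property G \<mu> \<longleftrightarrow>
    (\<forall>A. A \<noteq> {} \<and> A \<subseteq> carrier G \<longrightarrow> (\<exists>a0\<in>A. (SUP a\<in>A. \<mu> a) = \<mu> a0))"

definition limage ::
  "('a, 'm) monoid_scheme \<Rightarrow> ('a \<Rightarrow> 'b) \<Rightarrow> ('a \<Rightarrow> 'l::complete_distrib_lattice) \<Rightarrow> 'b \<Rightarrow> 'l"
  where "limage G f \<mu> = (\<lambda>y. SUP x\<in>{x \<in> carrier G. f x = y}. \<mu> x)"

text \<open>
  The \<open>L\<close>-point \<open>a\<^sub>x\<close> is represented by the pair of \<open>a\<close> and \<open>x\<close>.  No ambiguity arises from the
  fact that \<open>a = bot\<close> gives the same function for every \<open>x\<close>, since membership and conjugation
  by \<open>bot\<^sub>x\<close> do not depend on \<open>x\<close>.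
\<close>

definition lpoint_in :: "'l::complete_distrib_lattice \<Rightarrow> 'a \<Rightarrow> ('a \<Rightarrow> 'l) \<Rightarrow> bool"
  where "lpoint_in a x \<mu> \<longleftrightarrow> a \<le> \<mu> x"

definition lconjugate ::
  "('a, 'm) monoid_scheme \<Rightarrow> ('a \<Rightarrow> 'l::complete_distrib_lattice) \<Rightarrow> 'l \<Rightarrow> 'a \<Rightarrow> 'a \<Rightarrow> 'l"
  where "lconjugate G \<eta> a z = (\<lambda>x. inf a (\<eta> (z \<otimes>\<^bsub>G\<^esub> x \<otimes>\<^bsub>G\<^esub> inv\<^bsub>G\<^esub> z)))"

definition lgenerated ::
  "('a, 'm) monoid_scheme \<Rightarrow> ('a \<Rightarrow> 'l::complete_distrib_lattice) \<Rightarrow> ('a \<Rightarrow> 'l) \<Rightarrow> ('a \<Rightarrow> 'l) \<Rightarrow> 'a \<Rightarrow> 'l"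
  where "lgenerated G \<mu> \<eta> \<nu> =
    (\<lambda>x. INF \<theta>\<in>{\<theta>. lsubgroup_of G \<mu> \<theta> \<and> lsubset_le G (lunion \<eta> \<nu>) \<theta>}. \<theta> x)"

definition abnormal_lsubgroup ::
  "('a, 'm) monoid_scheme \<Rightarrow> ('a \<Rightarrow> 'l::complete_distrib_lattice) \<Rightarrow> ('a \<Rightarrow> 'l) \<Rightarrow> bool"
  where "abnormal_lsubgroup G \<mu> \<eta> \<longleftrightarrow>
    lsubgroup_of G \<mu> \<eta> \<and>
    (\<forall>a. \<forall>x\<in>carrier G. lpoint_in a x \<mu> \<longrightarrow>
       lpoint_in a x (lgenerated G \<mu> \<eta> (lconjugate G \<eta> a x)))"

end

theory Submission imports Defs begin

text \<open>
  By the sup-property, an \<open>L\<close>-point \<open>a\<^sub>y\<close> of \<open>f(\<mu>)\<close> lifts to an \<open>L\<close>-point \<open>a\<^sub>x\<close> of \<open>\<mu>\<close> with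
  \<open>f x = y\<close>.  If \<open>\<theta>\<close> is an \<open>L\<close>-subgroup of \<open>f(\<mu>)\<close> above \<open>f(\<eta>)\<close> and its conjugate by \<open>a\<^sub>y\<close>,
  then the pullback \<open>\<mu> \<inter> f\<inverse>(\<theta>)\<close> is an \<open>L\<close>-subgroup of \<open>\<mu>\<close> above \<open>\<eta>\<close> and its conjugate by
  \<open>a\<^sub>x\<close>.  Abnormality of \<open>\<eta>\<close> puts \<open>a\<^sub>x\<close> into the pullback, so \<open>a\<^sub>y\<close> lies in \<open>\<theta>\<close>.
\<close>

lemma lsubgroup_mult:
  "\<lbrakk>lsubgroup G \<mu>; x \<in> carrier G; y \<in> carrier G\<rbrakk> \<Longrightarrow> inf (\<mu> x) (\<mu> y) \<le> \<mu> (x \<otimes>\<^bsub>G\<^esub> y)"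
  by (simp add: lsubgroup_def)

lemma lsubgroup_inv:
  "\<lbrakk>lsubgroup G \<mu>; x \<in> carrier G\<rbrakk> \<Longrightarrow> \<mu> (inv\<^bsub>G\<^esub> x) = \<mu> x"
  by (simp add: lsubgroup_def)

lemma limage_upper: "x \<in> carrier G \<Longrightarrow> \<mu> x \<le> limage G f \<mu> (f x)"
  unfolding limage_def by (rule SUP_upper) simp

lemma limage_least:
  "(\<And>x. \<lbrakk>x \<in> carrier G; f x = y\<rbrakk> \<Longrightarrow> \<mu> x \<le> c) \<Longrightarrow> limage G f \<mu> y \<le> c"
  unfolding limage_def by (rule SUP_least) simp

text \<open>Binary meets distribute over arbitrary joins in \<open>L\<close>, so a meet of two image
  values is a join of meets taken over pairs of preimages.\<close>

lemma inf_limage_least: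
  assumes "\<And>u v. \<lbrakk>u \<in> carrier G; f u = y; v \<in> carrier G; f v = z\<rbrakk> \<Longrightarrow> inf (\<mu> u) (\<mu> v) \<le> c"
  shows "inf (limage G f \<mu> y) (limage G f \<mu> z) \<le> c"
  unfolding limage_def SUP_inf_distrib2 using assms by (intro SUP_least) simp

lemma limage_mono:
  "lsubset_le G \<eta> \<mu> \<Longrightarrow> limage G f \<eta> y \<le> limage G f \<mu> y"
  unfolding limage_def lsubset_le_def by (rule SUP_subset_mono) auto

text \<open>The sup-property is applied to the fibre over \<open>y\<close>, which is non-empty
  because \<open>y\<close> lies in the range. In general, an element below a supremum need not lie
  below any single member; attainment is what lets an \<open>L\<close>-point be lifted.\<close>

lemma limage_attained:
  assumes "sup_property G \<mu>" and "y \<in> f ` carrier G"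
  obtains x where "x \<in> carrier G" "f x = y" "limage G f \<mu> y = \<mu> x"
proof -
  let ?A = "{x \<in> carrier G. f x = y}"
  have "?A \<noteq> {} \<and> ?A \<subseteq> carrier G"
    using assms(2) by auto
  then obtain x where "x \<in> ?A" "(SUP x\<in>?A. \<mu> x) = \<mu> x"
    using assms(1) unfolding sup_property_def by meson
  then show thesis
    by (intro that[of x]) (simp_all add: limage_def)
qed

lemma (in group_hom) lsubgroup_limage:
  assumes surj: "h ` carrier G = carrier H" and \<mu>: "lsubgroup G \<mu>"
  shows "lsubgroup H (limage G h \<mu>)"
  unfolding lsubgroup_def
proof (intro conjI ballI)
  fix y z assume "y \<in> carrier H" "z \<in> carrier H"
  have "inf (\<mu> u) (\<mu> v) \<le> limage G h \<mu> (y \<otimes>\<^bsub>H\<^esub> z)"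
    if "u \<in> carrier G" "h u = y" "v \<in> carrier G" "h v = z" for u v
  proof -
    have "inf (\<mu> u) (\<mu> v) \<le> \<mu> (u \<otimes> v)"
      using \<mu> that by (simp add: lsubgroup_mult)
    also have "\<dots> \<le> limage G h \<mu> (h (u \<otimes> v))"
      using that by (intro limage_upper) simp
    finally show ?thesis
      using that by simp
  qed
  then show "inf (limage G h \<mu> y) (limage G h \<mu> z) \<le> limage G h \<mu> (y \<otimes>\<^bsub>H\<^esub> z)"
    by (rule inf_limage_least)
next
  \<comment> \<open>One inequality suffices: used again at the inverse of \<open>y\<close>, it gives
    the converse, since inversion is an involution on the carrier of \<open>H\<close>.\<close>
  have le: "limage G h \<mu> y \<le> limage G h \<mu> (inv\<^bsub>H\<^esub> y)" for y
  proof (rule limage_least)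
    fix x assume x: "x \<in> carrier G" "h x = y"
    then have "\<mu> x = \<mu> (inv x)"
      using \<mu> by (simp add: lsubgroup_inv)
    also have "\<dots> \<le> limage G h \<mu> (h (inv x))"
      using x by (intro limage_upper) simp
    finally show "\<mu> x \<le> limage G h \<mu> (inv\<^bsub>H\<^esub> y)"
      using x by simp
  qed
  fix y assume "y \<in> carrier H"
  then show "limage G h \<mu> (inv\<^bsub>H\<^esub> y) = limage G h \<mu> y"
    using le[of y] le[of "inv\<^bsub>H\<^esub> y"] by (simp add: order.antisym)
qed

text \<open>Since \<open>h\<close> respects products and inverses, \<theta> composed with
  \<open>h\<close> satisfies the laws of an \<open>L\<close>-subgroup; the meet with \<mu> preserves
  them and forces containment in \<mu>.\<close>

lemma (in group_hom) lsubgroup_of_pullback: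
  assumes \<mu>: "lsubgroup G \<mu>" and \<theta>: "lsubgroup H \<theta>"
  shows "lsubgroup_of G \<mu> (\<lambda>x. inf (\<mu> x) (\<theta> (h x)))"
  unfolding lsubgroup_of_def
proof
  have "inf (inf (\<mu> x) (\<theta> (h x))) (inf (\<mu> y) (\<theta> (h y))) \<le> inf (\<mu> (x \<otimes> y)) (\<theta> (h (x \<otimes> y)))"
    if "x \<in> carrier G" "y \<in> carrier G" for x y
  proof -
    have "inf (inf (\<mu> x) (\<theta> (h x))) (inf (\<mu> y) (\<theta> (h y)))
        = inf (inf (\<mu> x) (\<mu> y)) (inf (\<theta> (h x)) (\<theta> (h y)))"
      by (simp add: ac_simps)
    also have "\<dots> \<le> inf (\<mu> (x \<otimes> y)) (\<theta> (h x \<otimes>\<^bsub>H\<^esub> h y))"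
      using \<mu> \<theta> that by (intro inf_mono lsubgroup_mult) auto
    finally show ?thesis
      using that by simp
  qed
  then show "lsubgroup G (\<lambda>x. inf (\<mu> x) (\<theta> (h x)))"
    using \<mu> \<theta> by (simp add: lsubgroup_def)
qed (simp add: lsubset_le_def)

text \<open>Conjugating back recovers \<open>x\<close> as the product of \<open>inv z\<close>,
  \<open>?c\<close> and \<open>z\<close>, so \<mu> at \<open>x\<close> dominates the meet of its
  values at these three factors.\<close>

lemma (in group) lconjugate_le:
  assumes \<mu>: "lsubgroup G \<mu>" and \<eta>: "lsubset_le G \<eta> \<mu>"
    and z: "z \<in> carrier G" "a \<le> \<mu> z"
  shows "lsubset_le G (lconjugate G \<eta> a z) \<mu>"
  unfolding lsubset_le_def lconjugate_def
proof
  fix x assume x: "x \<in> carrier G"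
  let ?c = "z \<otimes> x \<otimes> inv z"
  have c: "?c \<in> carrier G" using x z by simp
  \<comment> \<open>The single bound by \<open>a\<close> serves both outer factors, because \<mu>
    agrees at \<open>z\<close> and \<open>inv z\<close>.\<close>
  have "inf a (\<eta> ?c) \<le> inf (inf (\<mu> (inv z)) (\<mu> ?c)) (\<mu> z)"
    using \<eta> c z lsubgroup_inv[OF \<mu> z(1)]
    by (auto simp: lsubset_le_def intro: le_infI1 le_infI2)
  also have "\<dots> \<le> inf (\<mu> (inv z \<otimes> ?c)) (\<mu> z)"
    using lsubgroup_mult[OF \<mu> inv_closed[OF z(1)] c] by (rule inf_mono) simp
  also have "\<dots> \<le> \<mu> (inv z \<otimes> ?c \<otimes> z)"
    using c z by (intro lsubgroup_mult[OF \<mu>]) auto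
  also have "inv z \<otimes> ?c \<otimes> z = x"
    using x z by (simp add: m_assoc flip: m_assoc[of "inv z" z])
  finally show "inf a (\<eta> ?c) \<le> \<mu> x" .
qed

text \<open>Here \<open>x\<close> is the conjugating element; \<open>h\<close> carries the conjugate
  of \<open>z\<close> by \<open>x\<close> to that of \<open>h z\<close> by
  \<open>h x\<close>.\<close>

lemma (in group_hom) lconjugate_le_limage:
  assumes "x \<in> carrier G" "z \<in> carrier G"
  shows "lconjugate G \<eta> a x z \<le> lconjugate H (limage G h \<eta>) a (h x) (h z)"
proof -
  have "\<eta> (x \<otimes> z \<otimes> inv x) \<le> limage G h \<eta> (h (x \<otimes> z \<otimes> inv x))"
    using assms by (intro limage_upper) simp
  then show ?thesis
    using assms by (simp add: lconjugate_def le_infI2)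
qed

theorem theorem3p7:
  fixes G :: "('a, 'm) monoid_scheme"
    and H :: "('b, 'n) monoid_scheme"
    and f :: "'a \<Rightarrow> 'b"
    and \<mu> \<eta> :: "'a \<Rightarrow> 'l::complete_distrib_lattice"
  assumes "group G" and "group H"
    and "f \<in> hom G H" and "f ` carrier G = carrier H"
    and "lsubgroup G \<mu>" and "sup_property G \<mu>"
    and "abnormal_lsubgroup G \<mu> \<eta>"
  shows "abnormal_lsubgroup H (limage G f \<mu>) (limage G f \<eta>)"
proof -
  interpret group_hom G H f
    using assms by (simp add: group_hom_def group_hom_axioms_def)
  have \<eta>: "lsubgroup G \<eta>" "lsubset_le G \<eta> \<mu>"
    using assms(7) by (auto simp: abnormal_lsubgroup_def lsubgroup_of_def)
  have "lsubgroup_of H (limage G f \<mu>) (limage G f \<eta>)"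
    using lsubgroup_limage[OF assms(4) \<eta>(1)] limage_mono[OF \<eta>(2), of f]
    by (simp add: lsubgroup_of_def lsubset_le_def)
  \<comment> \<open>The generated \<open>L\<close>-subgroup is an infimum, so membership of the
    \<open>L\<close>-point is checked against each competitor \<theta> separately.\<close>
  moreover have "a \<le> \<theta> y"
    if y: "y \<in> carrier H" "a \<le> limage G f \<mu> y"
      and \<theta>: "lsubgroup_of H (limage G f \<mu>) \<theta>"
        "lsubset_le H (lunion (limage G f \<eta>) (lconjugate H (limage G f \<eta>) a y)) \<theta>"
    for a y \<theta>
  proof -
    obtain x where x: "x \<in> carrier G" "f x = y" "limage G f \<mu> y = \<mu> x"
      using limage_attained[OF assms(6), of y f] y(1) assms(4) by blast
    then have ax: "a \<le> \<mu> x" using y by simp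
    let ?\<theta>' = "\<lambda>z. inf (\<mu> z) (\<theta> (f z))"
    have "lsubgroup_of G \<mu> ?\<theta>'"
      using \<theta>(1) assms(5) by (intro lsubgroup_of_pullback) (auto simp: lsubgroup_of_def)
    moreover have "lsubset_le G (lunion \<eta> (lconjugate G \<eta> a x)) ?\<theta>'"
      unfolding lsubset_le_def
    proof
      fix z assume z: "z \<in> carrier G"
      have "lunion \<eta> (lconjugate G \<eta> a x) z \<le> \<mu> z"
        using \<eta>(2) G.lconjugate_le[OF assms(5) \<eta>(2) x(1) ax] z
        by (simp add: lsubset_le_def lunion_def)
      moreover have "lunion \<eta> (lconjugate G \<eta> a x) z
          \<le> lunion (limage G f \<eta>) (lconjugate H (limage G f \<eta>) a y) (f z)"
        using limage_upper[OF z, of \<eta> f] lconjugate_le_limage[OF x(1) z, of \<eta> a] x(2)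
        unfolding lunion_def by (intro sup_mono) auto
      then have "lunion \<eta> (lconjugate G \<eta> a x) z \<le> \<theta> (f z)"
        using \<theta>(2) z unfolding lsubset_le_def by (meson hom_closed order_trans)
      ultimately show "lunion \<eta> (lconjugate G \<eta> a x) z \<le> ?\<theta>' z"
        by simp
    qed
    \<comment> \<open>The pullback is now one of the competitors in the infimum upstairs, hence an
      upper bound for it at \<open>x\<close>.\<close>
    ultimately have "lgenerated G \<mu> \<eta> (lconjugate G \<eta> a x) x \<le> ?\<theta>' x"
      unfolding lgenerated_def by (intro INF_lower) simp
    moreover have "a \<le> lgenerated G \<mu> \<eta> (lconjugate G \<eta> a x) x"
      using assms(7) x(1) ax by (simp add: abnormal_lsubgroup_def lpoint_in_def)
    ultimately show ?thesis
      using x(2) by (meson le_inf_iff order_trans)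
  qed
  ultimately show ?thesis
    unfolding abnormal_lsubgroup_def lpoint_in_def lgenerated_def
    by (auto intro!: INF_greatest)
qed

end
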